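(* Let $f(X)\in\mathbb{F}_q[X]$ be a nonconstant squarefree polynomial coprime to $X$ with order $m$, and suppose its defining set $T_f\subseteq\mathbb{Z}/m\mathbb{Z}$ decomposes into $q$-cyclotomic cosets modulo $m$ as $T_f=\bigsqcup_{i=1}^{t}c_{m/q}(\gamma_i)$, with integers $\gamma_i$. Let $d_i=\gamma_{i+1}-\gamma_i$ for $1\le i\le t-1$ and $d_f=\gcd(d_1,\dots,d_{t-1},m,q-1)$. Then the minimal binomial order of $f$ is $\frac m{d_f}$, and the minimal binomial multiple of $f$ is $X^{\frac m{d_f}}-\zeta_m^{\frac{\gamma m}{d_f}}$, where $\gamma$ is any of $\gamma_1,\dots,\gamma_t$.
   Context: The order of $g$ is the least positive $m$ with $g\mid X^m-1$. $\{\zeta_n:\gcd(n,q)=1\}$ is a fixed compatible family of primitive roots of unity ($\zeta_n^{n/k}=\zeta_k$ for $k\mid n$). The defining set of squarefree $f$ of order $m$ is $T_f\subseteq\mathbb{Z}/m\mathbb{Z}$ with $f=a\prod_{\gamma\in T_f}(X-\zeta_m^\gamma)$, $a\in\mathbb{F}_q^\ast$. $c_{m/q}(\gamma)=\{\gamma,\gamma q,\gamma q^2,\dots\}\subseteq\mathbb{Z}/m\mathbb{Z}$. A binomial is $X^n-\lambda$, $n\ge1$, $\lambda\in\mathbb{F}_q^\ast$; the minimal binomial multiple is the monic binomial over $\mathbb{F}_q$ of least degree divisible by $f$, its degree being the minimal binomial order. *)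

theory Defs
  imports
    "HOL-Algebra.Algebraic_Closure_Type"
    "HOL-Computational_Algebra.Computational_Algebra"
    "HOL-Library.Cardinality"
    "HOL-Library.Disjoint_Sets"
begin

(* The field with q elements is a type 'a of class finite_field with q = CARD('a); roots of
   unity live in its algebraic closure 'a alg_closure, into which it embeds by to_ac.
   Elements of Z/mZ are represented by their residues in {0..<m}. *)

definition poly_order :: "'a::finite_field poly \<Rightarrow> nat" where
  "poly_order g = (LEAST m. 0 < m \<and> g dvd monom 1 m - 1)"

definition primitive_root_of_unity :: "nat \<Rightarrow> 'a::field \<Rightarrow> bool" where
  "primitive_root_of_unity n x \<longleftrightarrow> 0 < n \<and> x ^ n = 1 \<and> (\<forall>k\<in>{0<..<n}. x ^ k \<noteq> 1)"

(* Only the values of \<zeta> at indices coprime to q are constrained. *)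
definition compatible_roots_of_unity :: "(nat \<Rightarrow> 'a::finite_field alg_closure) \<Rightarrow> bool" where
  "compatible_roots_of_unity \<zeta> \<longleftrightarrow>
     (\<forall>n. coprime n CARD('a) \<longrightarrow>
        primitive_root_of_unity n (\<zeta> n) \<and> (\<forall>k. k dvd n \<longrightarrow> \<zeta> n ^ (n div k) = \<zeta> k))"

(* For squarefree f coprime to X, the order m of f is coprime to q, so that \<zeta> m is a
   primitive m-th root of unity and the set described here exists and is unique. *)
definition defining_set ::
    "(nat \<Rightarrow> 'a::finite_field alg_closure) \<Rightarrow> 'a poly \<Rightarrow> int set" where
  "defining_set \<zeta> f =
     (THE T. T \<subseteq> {0..<int (poly_order f)} \<and>
        (\<exists>a. a \<noteq> 0 \<and>
          map_poly to_ac f = smult (to_ac a) (\<Prod>\<gamma>\<in>T. [:- (\<zeta> (poly_order f) powi \<gamma>), 1:])))"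

definition cyclotomic_coset :: "nat \<Rightarrow> nat \<Rightarrow> int \<Rightarrow> int set" where
  "cyclotomic_coset m q \<gamma> = {(\<gamma> * int q ^ j) mod int m | j. True}"

definition is_binomial :: "'a::finite_field poly \<Rightarrow> bool" where
  "is_binomial p \<longleftrightarrow> (\<exists>n c. 1 \<le> n \<and> c \<noteq> 0 \<and> p = monom 1 n - [:c:])"

(* Binomials in the above sense are monic. For nonconstant f there is at most one binomial
   multiple of least degree: the difference of two is a constant divisible by f. *)
definition minimal_binomial_multiple :: "'a::finite_field poly \<Rightarrow> 'a poly" where
  "minimal_binomial_multiple f =
     (THE g. is_binomial g \<and> f dvd g \<and> (\<forall>h. is_binomial h \<and> f dvd h \<longrightarrow> degree g \<le> degree h))"

definition minimal_binomial_order :: "'a::finite_field poly \<Rightarrow> nat" where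
  "minimal_binomial_order f = degree (minimal_binomial_multiple f)"

end

theory Submission
  imports
    Defs
    "HOL-Algebra.Multiplicative_Group"
    "HOL-Algebra.Sylow"
begin

text \<open>
  Over the closure \<open>f\<close> is, up to a constant, the product of the distinct linear factors
  \<open>X - \<zeta>^\<gamma>\<close> with \<open>\<gamma>\<close> in the defining set, so \<open>f\<close> divides \<open>X^n - c\<close> iff every root \<open>\<zeta>^\<gamma>\<close>
  satisfies \<open>(\<zeta>^\<gamma>)^n = c\<close>. If \<open>c\<close> is a nonzero element of the base field, then \<open>c^(q - 1) = 1\<close>, hence
  \<open>f\<close> divides \<open>X^(n(q - 1)) - 1\<close> and \<open>m\<close> divides \<open>n(q - 1)\<close>; comparing two roots, \<open>m\<close> divides each
  \<open>n d\<^sub>i\<close>. Therefore \<open>m\<close> divides \<open>n d\<^sub>f\<close>, that is \<open>m / d\<^sub>f\<close> divides \<open>n\<close>. Conversely, for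
  \<open>n = m / d\<^sub>f\<close> all \<open>(\<zeta>^\<gamma>)^n\<close> agree, because \<open>d\<^sub>f\<close> divides the \<open>d\<^sub>i\<close> and \<open>q - 1\<close>, and their common
  value is fixed by the Frobenius map, so it lies in the base field.
\<close>

section \<open>Bezout identity and squarefree divisors of powers\<close>

text \<open>
  The library provides gcds of polynomials only over fields with a gcd instance, which the sort
  \<open>finite_field\<close> does not include.
\<close>

lemma poly_bezout:
  fixes f g :: "'a::field poly"
  assumes "f \<noteq> 0"
  obtains h a b where "h = a * f + b * g" "h dvd f" "h dvd g"
proof -
  define P where "P = (\<lambda>h. h \<noteq> 0 \<and> (\<exists>a b. h = a * f + b * g))"
  have Pf: "P f"
    unfolding P_def using assms by (intro conjI exI[of _ 1] exI[of _ 0]) auto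
  \<comment> \<open>A nonzero combination of least degree serves as the gcd.\<close>
  define h where "h = arg_min degree P"
  have Ph: "P h" and min: "\<And>k. P k \<Longrightarrow> degree h \<le> degree k"
    using arg_min_nat_lemma[of P f degree] Pf unfolding h_def by auto
  from Ph obtain a b where h0: "h \<noteq> 0" and h: "h = a * f + b * g"
    unfolding P_def by auto
  \<comment> \<open>The remainder modulo \<open>h\<close> is again a combination of \<open>f\<close>
    and \<open>g\<close>, of smaller degree, so it vanishes.\<close>
  have dvd: "h dvd a' * f + b' * g" for a' b'
  proof (rule ccontr)
    let ?k = "a' * f + b' * g"
    assume "\<not> h dvd ?k"
    hence r0: "?k mod h \<noteq> 0"
      by (simp add: dvd_eq_mod_eq_0)
    have "?k mod h = ?k - (?k div h) * h"
      by (simp add: minus_div_mult_eq_mod)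
    also have "\<dots> = (a' - (?k div h) * a) * f + (b' - (?k div h) * b) * g"
      using arg_cong[OF h, of "(*) (?k div h)"] by (simp add: algebra_simps)
    finally have "P (?k mod h)"
      unfolding P_def using r0 by auto
    from min[OF this] degree_mod_less'[OF h0 r0] show False
      by simp
  qed
  show thesis
    using that[OF h] dvd[of 1 0] dvd[of 0 1] by simp
qed

text \<open>Split \<open>f\<close> as \<open>h * u\<close> with \<open>h\<close> a gcd of
  \<open>f\<close> and \<open>g\<close>; it suffices that \<open>u\<close> is a unit. Used with the
  characteristic as exponent to show that the order is coprime to q.\<close>

lemma squarefree_poly_dvd_power:
  fixes f g :: "'a::field poly"
  assumes "squarefree f" "f \<noteq> 0" "f dvd g ^ n"
  shows "f dvd g"
proof -
  obtain h a b where h: "h = a * f + b * g" "h dvd f" "h dvd g"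
    using poly_bezout[OF assms(2)] .
  then obtain u where u: "f = h * u"
    by blast
  with assms(2) have "u \<noteq> 0"
    by auto
  obtain e c d where e: "e = c * u + d * h" "e dvd u" "e dvd h"
    using poly_bezout[OF \<open>u \<noteq> 0\<close>] .
  txt \<open>By squarefreeness \<open>u\<close> and \<open>h\<close> are coprime, so \<open>g\<close> is invertible modulo \<open>u\<close>; as \<open>u\<close> divides a power of \<open>g\<close>,
    it is a unit.\<close>
  have "e ^ 2 dvd f"
    using e(2,3) unfolding u power2_eq_square by (simp add: mult.commute mult_dvd_mono)
  with assms(1) have "e dvd 1"
    unfolding squarefree_def by blast
  then obtain e' where "1 = e * e'" ..
  hence one: "1 = (e' * c + e' * d * a * h) * u + e' * d * b * g"
  proof -
    have "1 = e' * (c * u + d * (a * (h * u) + b * g))"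
      using \<open>1 = e * e'\<close> e(1) h(1) unfolding u by (simp only: mult.commute)
    thus ?thesis
      by (simp add: algebra_simps)
  qed
  let ?w = "e' * d * b * g"
  have "u dvd 1 - ?w"
    by (subst one) simp
  moreover have "1 - ?w dvd 1 - ?w ^ n"
    using one_diff_power_eq[of ?w n] by simp
  ultimately have "u dvd 1 - ?w ^ n"
    by (rule dvd_trans)
  moreover have "u dvd ?w ^ n"
    using assms(3) unfolding u power_mult_distrib by (meson dvd_mult dvd_mult_right)
  ultimately have "u dvd 1"
    using dvd_add[of u "1 - ?w ^ n" "?w ^ n"] by simp
  hence "h * u dvd h * 1"
    by (intro mult_dvd_mono) auto
  thus ?thesis
    using h(3) u by (simp add: dvd_trans[of "h * u" h g])
qed

section \<open>The order of a polynomial\<close>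

text \<open>Since 0 is not a root of \<open>f\<close>, the cofactor must vanish there, and one
  factor X after the other can be cancelled.\<close>

lemma dvd_monom_mult_cancel:
  fixes f g :: "'a::field poly"
  assumes "poly f 0 \<noteq> 0" "f dvd monom 1 n * g"
  shows "f dvd g"
  using assms(2)
proof (induction n)
  case (Suc n)
  then obtain h where h: "[:0, 1:] * (monom 1 n * g) = f * h"
    by (auto simp: monom_Suc mult.assoc)
  have "poly ([:0, 1:] * (monom 1 n * g)) 0 = 0"
    by simp
  hence "poly h 0 = 0"
    using assms(1) unfolding h by simp
  then obtain h' where h': "h = [:0, 1:] * h'"
    by (metis dvdE minus_zero poly_eq_0_iff_dvd)
  have "[:0, 1:] * (monom 1 n * g) = [:0, 1:] * (f * h')"
    using h h' by (simp add: algebra_simps)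
  hence "monom 1 n * g = f * h'"
    by (metis mult_cancel_left one_neq_zero pCons_eq_0_iff)
  with Suc.IH show ?case
    by simp
qed (simp add: monom_0)

lemma finite_degree_le: "finite {p :: 'a::{finite,zero} poly. degree p \<le> n}"
proof (rule finite_subset)
  show "{p :: 'a poly. degree p \<le> n} \<subseteq> Poly ` {xs. set xs \<subseteq> UNIV \<and> length xs \<le> Suc n}"
  proof
    fix p :: "'a poly" assume "p \<in> {p. degree p \<le> n}"
    hence "length (coeffs p) \<le> Suc n"
      by (cases "p = 0") (auto simp: length_coeffs_degree)
    thus "p \<in> Poly ` {xs. set xs \<subseteq> UNIV \<and> length xs \<le> Suc n}"
      by (intro image_eqI[of _ _ "coeffs p"]) auto
  qed
  show "finite (Poly ` {xs :: 'a list. set xs \<subseteq> UNIV \<and> length xs \<le> Suc n})"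
    by (intro finite_imageI finite_lists_length_le) auto
qed

text \<open>Pigeonhole: there are finitely many residues modulo \<open>f\<close>, so two powers of X
  agree, and the lower one cancels.\<close>

lemma ex_dvd_monom_minus_1:
  fixes f :: "'a::finite_field poly"
  assumes "poly f 0 \<noteq> 0"
  shows "\<exists>m>0. f dvd monom 1 m - 1"
proof -
  let ?r = "\<lambda>n. monom 1 n mod f"
  have f0: "f \<noteq> 0"
    using assms by auto
  have "range ?r \<subseteq> {p. degree p \<le> degree f}"
    using degree_mod_less[OF f0] by (metis (mono_tags, lifting) degree_0 image_subsetI le0 less_imp_le mem_Collect_eq)
  hence "finite (range ?r)"
    using finite_degree_le finite_subset by blast
  hence "\<not> inj ?r"
    using finite_imageD infinite_UNIV_nat by blast
  then obtain i j where ij: "i < j" "?r i = ?r j"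
    by (auto simp: inj_def) (metis linorder_neqE_nat)
  hence "f dvd monom 1 j - monom 1 i"
    by (metis mod_eq_dvd_iff)
  also have "monom 1 j - monom 1 i = monom 1 i * (monom 1 (j - i) - (1 :: 'a poly))"
    using ij(1) by (simp add: algebra_simps mult_monom)
  finally have "f dvd monom 1 (j - i) - 1"
    by (rule dvd_monom_mult_cancel[OF assms])
  thus ?thesis
    using ij(1) by (intro exI[of _ "j - i"]) simp
qed

text \<open>Cauchy's theorem for the additive group, obtained from Sylow's theorem with exponent 1:
  a nonzero \<open>x\<close> in a subgroup of order \<open>p\<close> satisfies
  \<open>of_nat p * x = 0\<close>.\<close>

lemma prime_dvd_CARD_eq_CHAR:
  assumes "prime p" "p dvd CARD('a::finite_field)"
  shows "p = CHAR('a)"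
proof -
  define G where "G = \<lparr>carrier = (UNIV :: 'a set), monoid.mult = (+), one = (0 :: 'a)\<rparr>"
  interpret G: group G
    by (rule groupI) (auto simp: G_def add.assoc intro: exI[of _ "- x" for x])
  have pow: "x [^]\<^bsub>G\<^esub> n = of_nat n * x" for x and n :: nat
    by (induction n) (auto simp: G_def algebra_simps nat_pow_def)
  obtain k where k: "CARD('a) = p * k"
    using assms(2) by blast
  obtain H where H: "subgroup H G" "card H = p ^ 1"
    using sylow_thm[OF assms(1) G.is_group, of 1 k] k unfolding G_def Coset.order_def by auto
  have "card H > 1"
    using H(2) assms(1) prime_gt_1_nat by simp
  hence "\<not> H \<subseteq> {0}"
    using card_mono[of "{0::'a}" H] by auto
  then obtain x where x: "x \<in> H" "x \<noteq> 0"
    by auto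
  interpret H: group "G\<lparr>carrier := H\<rparr>"
    using subgroup.subgroup_is_group[OF H(1) G.is_group] .
  have "x [^]\<^bsub>G\<lparr>carrier := H\<rparr>\<^esub> p = \<one>\<^bsub>G\<lparr>carrier := H\<rparr>\<^esub>"
    using H.pow_order_eq_1[of x] x(1) H(2) by (simp add: Coset.order_def)
  hence "x [^]\<^bsub>G\<^esub> p = \<one>\<^bsub>G\<^esub>"
    by (simp add: nat_pow_def)
  hence "of_nat p * x = 0"
    by (simp add: pow) (simp add: G_def)
  hence "CHAR('a) dvd p"
    using x(2) of_nat_eq_0_iff_char_dvd by auto
  thus ?thesis
    using assms(1) CHAR_prime[where 'a = 'a] primes_dvd_imp_eq by metis
qed

context
  fixes f :: "'a::finite_field poly"
  assumes f0: "poly f 0 \<noteq> 0"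
begin

lemma poly_order_pos: "poly_order f > 0"
  and dvd_monom_poly_order: "f dvd monom 1 (poly_order f) - 1"
  using LeastI_ex[OF ex_dvd_monom_minus_1[OF f0]] unfolding poly_order_def by auto

lemma poly_order_le: "0 < n \<Longrightarrow> f dvd monom 1 n - 1 \<Longrightarrow> poly_order f \<le> n"
  unfolding poly_order_def by (rule Least_le) auto

text \<open>With m the order, X^n and X^(n mod m) agree modulo \<open>f\<close>, so a nonzero n mod
  m would contradict the minimality of m.\<close>

lemma poly_order_dvd:
  assumes "f dvd monom 1 n - 1"
  shows "poly_order f dvd n"
proof (rule ccontr)
  let ?m = "poly_order f"
  assume "\<not> ?m dvd n"
  hence r: "0 < n mod ?m"
    by (simp add: dvd_eq_mod_eq_0)
  have "monom 1 ?m - 1 dvd (monom 1 ?m ^ (n div ?m) - 1 :: 'a poly)"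
    by (metis dvd_triv_left power_diff_1_eq)
  hence "f dvd monom 1 (n mod ?m) * (monom 1 ?m ^ (n div ?m) - 1)"
    using dvd_monom_poly_order by (meson dvd_mult dvd_trans)
  hence "f dvd monom 1 n - 1 - monom 1 (n mod ?m) * (monom 1 ?m ^ (n div ?m) - 1)"
    using assms by (rule dvd_diff[rotated])
  also have "\<dots> = monom 1 (n mod ?m) - 1"
    by (simp add: algebra_simps monom_power mult_monom)
  finally have "?m \<le> n mod ?m"
    using poly_order_le r by blast
  thus False
    using mod_less_divisor[OF poly_order_pos, of n] by simp
qed

text \<open>A common prime p would be the characteristic. With m = kp this gives X^m - 1 = (X^k -
  1)^p, so the squarefree \<open>f\<close> would divide X^k - 1 although k < m.\<close>

lemma poly_order_coprime_CARD:
  assumes "squarefree f"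
  shows "coprime (poly_order f) CARD('a)"
proof (rule ccontr)
  assume "\<not> ?thesis"
  then obtain p where p: "prime p" "p dvd poly_order f" "p dvd CARD('a)"
    using prime_factor_nat[of "gcd (poly_order f) CARD('a)"] by (auto simp: coprime_iff_gcd_eq_1)
  from p(2) obtain k where k: "poly_order f = k * p"
    by (metis dvdE mult.commute)
  have p_eq: "p = CHAR('a)"
    using p prime_dvd_CARD_eq_CHAR by blast
  \<comment> \<open>Writing X^k as (X^k - 1) + 1 avoids having to determine (-1)^p.\<close>
  have "(monom 1 k - 1 + 1 :: 'a poly) ^ p = (monom 1 k - 1) ^ p + 1 ^ p"
    by (rule freshmans_dream) (use p_eq p(1) in simp_all)
  hence "(monom 1 k - 1 :: 'a poly) ^ p = monom 1 (poly_order f) - 1"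
    by (simp add: monom_power k algebra_simps)
  hence "f dvd (monom 1 k - 1) ^ p"
    using dvd_monom_poly_order by simp
  hence "f dvd monom 1 k - 1"
    by (rule squarefree_poly_dvd_power[OF assms, rotated]) (use f0 in auto)
  moreover have "k > 0" "k < poly_order f"
    using poly_order_pos prime_gt_1_nat[OF p(1)] unfolding k by simp_all
  ultimately show False
    using poly_order_le[of k] by simp
qed

end

section \<open>Passage to the algebraic closure\<close>

lemma degree_monom_diff:
  fixes p :: "'a::comm_ring_1 poly"
  assumes "degree p < n"
  shows "degree (monom 1 n - p) = n"
  using degree_add_eq_left[of "- p" "monom 1 n"] assms by (simp add: degree_monom_eq)

lemma map_poly_to_ac_add: "map_poly to_ac (p + q) = map_poly to_ac p + map_poly to_ac q"
  by (rule poly_eqI) (simp add: coeff_map_poly)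

lemma map_poly_to_ac_diff: "map_poly to_ac (p - q) = map_poly to_ac p - map_poly to_ac q"
  by (rule poly_eqI) (simp add: coeff_map_poly)

lemma map_poly_to_ac_mult: "map_poly to_ac (p * q) = map_poly to_ac p * map_poly to_ac q"
  by (rule poly_eqI) (simp add: coeff_map_poly coeff_mult to_ac_sum)

text \<open>The embedding preserves division with remainder: the embedded remainder is a multiple of
  the embedded \<open>f\<close> of smaller degree, hence zero.\<close>

lemma map_poly_to_ac_dvd_iff:
  "map_poly to_ac f dvd map_poly to_ac g \<longleftrightarrow> f dvd g"
proof
  assume dvd: "map_poly to_ac f dvd map_poly to_ac g"
  have eq: "map_poly to_ac g = map_poly to_ac f * map_poly to_ac (g div f) + map_poly to_ac (g mod f)"
    by (metis map_poly_to_ac_add map_poly_to_ac_mult mult_div_mod_eq)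
  with dvd have dvd': "map_poly to_ac f dvd map_poly to_ac (g mod f)"
    by (metis dvd_add_right_iff dvd_triv_left)
  have deg: "degree (map_poly to_ac p) = degree p" for p :: "'a poly"
    by (rule degree_map_poly) simp
  have "g mod f = 0"
  proof (cases "f = 0")
    case True
    with dvd' show ?thesis
      by (metis dvd_0_left_iff map_poly_0 map_poly_eq_0_iff to_ac_eq_0_iff to_ac_0)
  next
    case False
    show ?thesis
    proof (rule ccontr)
      assume r0: "g mod f \<noteq> 0"
      hence "map_poly to_ac (g mod f) \<noteq> 0"
        by (simp add: map_poly_eq_0_iff)
      from dvd_imp_degree_le[OF dvd' this] degree_mod_less'[OF False r0] show False
        by (simp add: deg)
    qed
  qed
  thus "f dvd g"
    by (simp add: dvd_eq_mod_eq_0)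
next
  assume "f dvd g"
  thus "map_poly to_ac f dvd map_poly to_ac g"
    by (auto simp: map_poly_to_ac_mult)
qed

text \<open>X^q - X has at most q roots, and the q elements of the base field are already among
  them.\<close>

lemma power_CARD_eq_self_imp_in_range_to_ac:
  fixes x :: "'a::finite_field alg_closure"
  assumes "x ^ CARD('a) = x"
  shows "x \<in> range to_ac"
proof -
  let ?p = "monom 1 CARD('a) - [:0, 1:] :: 'a alg_closure poly"
  have q: "CARD('a) > 1"
    using card_mono[of "UNIV :: 'a set" "{0, 1}"] by simp
  have deg: "degree ?p = CARD('a)"
    using q by (intro degree_monom_diff) simp
  hence p0: "?p \<noteq> 0"
    using q by auto
  have sub: "range to_ac \<subseteq> {x. poly ?p x = 0}"
    using finite_field_power_card_eq_same by (auto simp: poly_monom simp flip: to_ac_power)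
  have "card {x. poly ?p x = 0} \<le> card (range (to_ac :: 'a \<Rightarrow> _))"
    using card_poly_roots_bound[OF p0] by (simp add: deg card_image inj_to_ac)
  hence "range to_ac = {x. poly ?p x = 0}"
    using sub poly_roots_finite[OF p0] card_seteq by blast
  with assms show ?thesis
    by (simp add: poly_monom)
qed

lemma prod_linear_dvd_iff:
  fixes p :: "'a::field poly"
  assumes "finite A"
  shows "(\<Prod>a\<in>A. [:- a, 1:]) dvd p \<longleftrightarrow> (\<forall>a\<in>A. poly p a = 0)"
proof
  assume "(\<Prod>a\<in>A. [:- a, 1:]) dvd p"
  thus "\<forall>a\<in>A. poly p a = 0"
    using assms by (meson dvd_prod_eqI dvd_trans poly_eq_0_iff_dvd)
next
  assume "\<forall>a\<in>A. poly p a = 0"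
  with assms show "(\<Prod>a\<in>A. [:- a, 1:]) dvd p"
  proof (induction A arbitrary: p)
    case (insert a A)
    from insert.prems obtain q where q: "p = [:- a, 1:] * q"
      by (auto simp: poly_eq_0_iff_dvd)
    have "\<forall>b\<in>A. poly q b = 0"
      using insert.prems insert.hyps(2) by (auto simp: q)
    hence "(\<Prod>a\<in>A. [:- a, 1:]) dvd q"
      by (rule insert.IH)
    thus ?case
      unfolding q prod.insert[OF insert.hyps] by (rule mult_dvd_mono[OF dvd_refl])
  qed auto
qed

section \<open>Powers of a primitive root of unity\<close>

lemma primitive_root_powi_eq_1_iff:
  assumes "primitive_root_of_unity n x"
  shows "x powi k = 1 \<longleftrightarrow> int n dvd k"
proof -
  have n: "n > 0" and x: "x ^ n = 1" and min: "\<And>k. 0 < k \<Longrightarrow> k < n \<Longrightarrow> x ^ k \<noteq> 1"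
    using assms by (auto simp: primitive_root_of_unity_def)
  have x0: "x \<noteq> 0"
    using x n by (auto simp: power_0_left)
  have "x powi k = x powi (int n * (k div int n) + k mod int n)"
    by simp
  also have "\<dots> = x ^ nat (k mod int n)"
    by (subst power_int_add) (use x0 x n in \<open>auto simp: power_int_mult power_int_nonneg_exp\<close>)
  finally have eq: "x powi k = x ^ nat (k mod int n)" .
  have "k mod int n < int n" "k mod int n \<ge> 0"
    using n by auto
  hence "x ^ nat (k mod int n) = 1 \<longleftrightarrow> k mod int n = 0"
    using min[of "nat (k mod int n)"] by (cases "k mod int n = 0") auto
  thus ?thesis
    by (simp add: eq dvd_eq_mod_eq_0)
qed

lemma primitive_root_powi_eq_iff:
  assumes "primitive_root_of_unity n x"
  shows "x powi k = x powi l \<longleftrightarrow> int n dvd k - l"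
proof -
  have "x \<noteq> 0"
    using assms by (auto simp: primitive_root_of_unity_def power_0_left)
  thus ?thesis
    using primitive_root_powi_eq_1_iff[OF assms, of "k - l"]
    by (simp add: power_int_diff power_int_not_zero)
qed

lemma primitive_root_inj_on:
  assumes "primitive_root_of_unity n x"
  shows "inj_on (\<lambda>k. x powi k) {0..<int n}"
proof (rule inj_onI)
  fix k l assume kl: "k \<in> {0..<int n}" "l \<in> {0..<int n}" "x powi k = x powi l"
  hence "int n dvd k - l"
    using primitive_root_powi_eq_iff[OF assms] by simp
  hence "k mod int n = l mod int n"
    by (simp add: mod_eq_dvd_iff)
  with kl show "k = l"
    by simp
qed

text \<open>The n powers are distinct roots of X^n - 1, which has at most n roots.\<close>

lemma primitive_root_image:
  fixes x :: "'a::field"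
  assumes "primitive_root_of_unity n x"
  shows "(\<lambda>k. x powi k) ` {0..<int n} = {y. y ^ n = 1}"
proof (rule card_seteq)
  have n: "n > 0" and x: "x ^ n = 1"
    using assms by (auto simp: primitive_root_of_unity_def)
  let ?p = "monom 1 n - 1 :: 'a poly"
  have deg: "degree ?p = n"
    using n by (intro degree_monom_diff) simp
  hence p0: "?p \<noteq> 0"
    using n by auto
  have roots: "{y. poly ?p y = 0} = {y. y ^ n = 1}"
    by (simp add: poly_monom)
  show "finite {y :: 'a. y ^ n = 1}"
    using poly_roots_finite[OF p0] unfolding roots by simp
  show "(\<lambda>k. x powi k) ` {0..<int n} \<subseteq> {y :: 'a. y ^ n = 1}"
    using x by (auto simp: power_int_power' mult.commute[of _ "int n"] power_int_mult)
  show "card {y :: 'a. y ^ n = 1} \<le> card ((\<lambda>k. x powi k) ` {0..<int n})"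
    using card_poly_roots_bound[OF p0] unfolding roots
    by (simp add: deg card_image primitive_root_inj_on[OF assms])
qed

section \<open>The defining set and divisibility of binomials\<close>

text \<open>Every prime factor of q equals the characteristic. Needed so that the derivative of X^m
  - 1 does not vanish at the roots.\<close>

lemma not_CHAR_dvd_of_coprime_CARD:
  assumes "coprime n CARD('a::finite_field)"
  shows "\<not> CHAR('a) dvd n"
proof
  assume dvd: "CHAR('a) dvd n"
  have "CARD('a) > 1"
    using card_mono[of "UNIV :: 'a set" "{0, 1}"] by simp
  then obtain p where p: "prime p" "p dvd CARD('a)"
    using prime_factor_nat[of "CARD('a)"] by auto
  hence "p dvd n"
    using dvd prime_dvd_CARD_eq_CHAR by metis
  with p assms show False
    using coprime_common_divisor_nat not_prime_1 by blast
qed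

lemma poly_nonzero_of_coprime_X:
  fixes f :: "'a::field poly"
  assumes "coprime f [:0, 1:]"
  shows "poly f 0 \<noteq> 0"
proof
  assume "poly f 0 = 0"
  hence "[:0, 1:] dvd f"
    by (simp add: poly_eq_0_iff_dvd)
  with assms have "[:0, 1 :: 'a:] dvd 1"
    using coprime_common_divisor dvd_refl by blast
  thus False
    by (simp add: is_unit_poly_iff)
qed

context
  fixes f :: "'a::finite_field poly" and \<zeta> :: "nat \<Rightarrow> 'a alg_closure"
  assumes f0: "poly f 0 \<noteq> 0" and sf: "squarefree f" and comp: "compatible_roots_of_unity \<zeta>"
begin

lemma primitive_root_poly_order: "primitive_root_of_unity (poly_order f) (\<zeta> (poly_order f))"
  using comp poly_order_coprime_CARD[OF f0 sf] by (auto simp: compatible_roots_of_unity_def)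

text \<open>The definite description in \<open>defining_set\<close> has exactly one solution, the
  set of exponents of the roots of \<open>f\<close>, so its defining property becomes
  available.\<close>

lemma defining_set_factorization:
  obtains a where "a \<noteq> 0" "defining_set \<zeta> f \<subseteq> {0..<int (poly_order f)}"
    "map_poly to_ac f =
       smult (to_ac a) (\<Prod>\<gamma>\<in>defining_set \<zeta> f. [:- (\<zeta> (poly_order f) powi \<gamma>), 1:])"
proof -
  define m where "m = poly_order f"
  define z where "z = \<zeta> m"
  define F where "F = map_poly to_ac f"
  define T where "T = {i \<in> {0..<int m}. poly F (z powi i) = 0}"
  define G where "G = (\<Prod>\<gamma>\<in>T. [:- (z powi \<gamma>), 1:])"
  have z: "primitive_root_of_unity m z"
    unfolding z_def m_def by (rule primitive_root_poly_order)
  have m: "m > 0"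
    using poly_order_pos[OF f0] by (simp add: m_def)
  have Tsub: "T \<subseteq> {0..<int m}"
    by (auto simp: T_def)
  hence finT: "finite T"
    by (rule finite_subset) simp
  have F0: "F \<noteq> 0"
    using f0 by (auto simp: F_def map_poly_eq_0_iff)
  have "inj_on (\<lambda>i. z powi i) T"
    using primitive_root_inj_on[OF z] Tsub by (rule inj_on_subset)
  hence G: "G = (\<Prod>x\<in>(\<lambda>i. z powi i) ` T. [:- x, 1:])"
    unfolding G_def by (simp add: prod.reindex)
  have "G dvd F"
    unfolding G using finT by (subst prod_linear_dvd_iff) (auto simp: T_def)
  then obtain H where H: "F = G * H" ..
  have "F dvd map_poly to_ac (monom 1 m - 1)"
    using dvd_monom_poly_order[OF f0] by (simp add: F_def m_def map_poly_to_ac_dvd_iff)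
  hence Fdvd: "F dvd monom 1 m - 1"
    by (simp add: map_poly_to_ac_diff map_poly_monom)
  txt \<open>A root of \<open>H\<close> would be a multiple root of \<open>X^m - 1\<close>, but \<open>m\<close> is nonzero in the field.\<close>
  have "degree H = 0"
  proof (rule ccontr)
    assume "degree H \<noteq> 0"
    then obtain x where x: "poly H x = 0"
      using alg_closed_imp_poly_has_root by blast
    have "[:- x, 1:] dvd monom 1 m - 1"
      using x Fdvd H by (metis dvd_mult dvd_trans poly_eq_0_iff_dvd)
    hence xm: "x ^ m = 1"
      by (simp flip: poly_eq_0_iff_dvd add: poly_monom)
    hence "x \<in> (\<lambda>i. z powi i) ` {0..<int m}"
      using primitive_root_image[OF z] by blast
    hence "x \<in> (\<lambda>i. z powi i) ` T"
      using x H by (auto simp: T_def)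
    hence "[:- x, 1:] dvd G"
      unfolding G using finT by blast
    moreover have "[:- x, 1:] dvd H"
      using x by (simp add: poly_eq_0_iff_dvd)
    ultimately have "[:- x, 1:] * [:- x, 1:] dvd monom 1 m - 1"
      by (rule dvd_trans[OF mult_dvd_mono Fdvd[unfolded H]])
    then obtain w where w: "monom 1 m - 1 = [:- x, 1:] * [:- x, 1:] * w"
      by (rule dvdE)
    have "poly (pderiv ([:- x, 1:] * [:- x, 1:] * w)) x = 0"
      by (simp only: pderiv_mult poly_add poly_mult) simp
    hence "of_nat m * x ^ (m - 1) = 0"
      unfolding w[symmetric] by (simp add: pderiv_diff pderiv_monom poly_monom)
    moreover have "x \<noteq> 0"
      using xm m by (auto simp: power_0_left)
    moreover have "(of_nat m :: 'a alg_closure) \<noteq> 0"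
      using not_CHAR_dvd_of_coprime_CARD[OF poly_order_coprime_CARD[OF f0 sf]]
      by (simp add: of_nat_eq_0_iff_char_dvd m_def)
    ultimately show False
      by simp
  qed
  then obtain c where c: "H = [:c:]"
    by (metis degree_eq_zeroE)
  \<comment> \<open>As \<open>G\<close> is monic, the constant \<open>H\<close> is the leading
    coefficient of \<open>f\<close>, so it comes from the base field as \<open>defining_set\<close>
    demands.\<close>
  have "lead_coeff G = 1"
    by (simp add: G_def lead_coeff_prod)
  hence "lead_coeff F = c"
    unfolding H c by (simp add: lead_coeff_mult del: mult_pCons_right)
  moreover have "lead_coeff F = to_ac (lead_coeff f)"
    unfolding F_def by (rule lead_coeff_map_poly_nz) (use f0 in auto)
  ultimately have "c = to_ac (lead_coeff f)"
    by (rule trans[OF sym])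
  hence fact: "F = smult (to_ac (lead_coeff f)) G"
    using H c by simp
  have a0: "lead_coeff f \<noteq> 0"
    using f0 by auto
  have "defining_set \<zeta> f = T"
    unfolding defining_set_def m_def[symmetric] z_def[symmetric] F_def[symmetric]
  proof (rule the_equality)
    show "T \<subseteq> {0..<int m} \<and>
      (\<exists>a. a \<noteq> 0 \<and> F = smult (to_ac a) (\<Prod>\<gamma>\<in>T. [:- (z powi \<gamma>), 1:]))"
      using Tsub fact a0 unfolding G_def by blast
  next
    fix S assume "S \<subseteq> {0..<int m} \<and>
      (\<exists>a. a \<noteq> 0 \<and> F = smult (to_ac a) (\<Prod>\<gamma>\<in>S. [:- (z powi \<gamma>), 1:]))"
    then obtain a where S: "S \<subseteq> {0..<int m}" "a \<noteq> 0"
      "F = smult (to_ac a) (\<Prod>\<gamma>\<in>S. [:- (z powi \<gamma>), 1:])"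
      by auto
    have fin: "finite S"
      using S(1) finite_subset by blast
    \<comment> \<open>Uniqueness: powers of \<open>z\<close> with exponents below \<open>m\<close>
      are distinct, so \<open>S\<close> can be read off from the roots.\<close>
    have "poly F (z powi i) = 0 \<longleftrightarrow> i \<in> S" if "i \<in> {0..<int m}" for i
    proof -
      have "poly F (z powi i) = 0 \<longleftrightarrow> (\<exists>\<gamma>\<in>S. z powi i = z powi \<gamma>)"
        using S(2) fin by (simp add: S(3) poly_prod)
      also have "\<dots> \<longleftrightarrow> i \<in> S"
        using S(1) that inj_onD[OF primitive_root_inj_on[OF z]] by blast
      finally show ?thesis .
    qed
    thus "S = T"
      using S(1) by (auto simp: T_def)
  qed
  with that[OF a0] Tsub fact show thesis
    by (simp add: G_def F_def m_def z_def)
qed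

text \<open>Divisibility may be tested in the closure, where the linear factors of \<open>f\<close>
  are distinct and it amounts to vanishing at each root.\<close>

lemma dvd_binomial_iff:
  "f dvd monom 1 n - [:c:] \<longleftrightarrow>
     (\<forall>\<gamma>\<in>defining_set \<zeta> f. (\<zeta> (poly_order f) powi \<gamma>) ^ n = to_ac c)"
proof -
  let ?T = "defining_set \<zeta> f" and ?z = "\<zeta> (poly_order f)"
  obtain a where a: "a \<noteq> 0" "?T \<subseteq> {0..<int (poly_order f)}"
    "map_poly to_ac f = smult (to_ac a) (\<Prod>\<gamma>\<in>?T. [:- (?z powi \<gamma>), 1:])"
    by (rule defining_set_factorization)
  have fin: "finite ?T"
    using a(2) finite_subset by blast
  have "inj_on (\<lambda>i. ?z powi i) ?T"
    using primitive_root_inj_on[OF primitive_root_poly_order] a(2) by (rule inj_on_subset)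
  hence eq: "(\<Prod>\<gamma>\<in>?T. [:- (?z powi \<gamma>), 1:]) = (\<Prod>x\<in>(\<lambda>i. ?z powi i) ` ?T. [:- x, 1:])"
    by (simp add: prod.reindex)
  have "f dvd monom 1 n - [:c:] \<longleftrightarrow> map_poly to_ac f dvd monom 1 n - [:to_ac c:]"
    by (subst map_poly_to_ac_dvd_iff[symmetric])
       (simp add: map_poly_to_ac_diff map_poly_monom map_poly_pCons)
  also have "\<dots> \<longleftrightarrow> (\<forall>\<gamma>\<in>?T. (?z powi \<gamma>) ^ n = to_ac c)"
    unfolding a(3) eq using fin a(1)
    by (simp add: smult_dvd_iff prod_linear_dvd_iff poly_monom)
  finally show ?thesis .
qed

lemma defining_set_nonempty:
  assumes "degree f > 0"
  shows "defining_set \<zeta> f \<noteq> {}"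
proof
  assume "defining_set \<zeta> f = {}"
  with defining_set_factorization obtain a where "map_poly to_ac f = [:to_ac a:]"
    by (metis prod.empty smult_one)
  hence "degree (map_poly to_ac f) = 0"
    by simp
  thus False
    using assms by (simp add: degree_map_poly)
qed

text \<open>Raising the root equations to the power q - 1 turns \<open>c\<close> into 1.\<close>

lemma poly_order_dvd_binomial_degree:
  assumes "f dvd monom 1 n - [:c:]" "c \<noteq> 0"
  shows "poly_order f dvd n * (CARD('a) - 1)"
proof -
  let ?q = "CARD('a)"
  have "c * c ^ (?q - 1) = c ^ ?q"
    by (metis finite_UNIV_card_ge_0 finite power_eq_if less_not_refl)
  hence c: "c ^ (?q - 1) = 1"
    using assms(2) by (simp add: finite_field_power_card_eq_same)
  have "(\<zeta> (poly_order f) powi \<gamma>) ^ (n * (?q - 1)) = to_ac 1" if "\<gamma> \<in> defining_set \<zeta> f" for \<gamma>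
    using that assms(1) c by (simp add: dvd_binomial_iff power_mult flip: to_ac_power)
  hence "f dvd monom 1 (n * (?q - 1)) - [:1:]"
    by (subst dvd_binomial_iff) blast
  thus ?thesis
    using poly_order_dvd[OF f0] by (simp add: one_pCons)
qed

end

section \<open>The minimal binomial multiple\<close>

theorem theorem10:
  fixes f :: "'a::finite_field poly"
    and \<zeta> :: "nat \<Rightarrow> 'a alg_closure"
    and \<gamma> d :: "nat \<Rightarrow> int"
    and m t d\<^sub>f :: nat
  assumes "compatible_roots_of_unity \<zeta>"
    and "degree f > 0"
    and "squarefree f"
    and "coprime f [:0, 1:]"
    and "m = poly_order f"
    and "defining_set \<zeta> f = (\<Union>i\<in>{1..t}. cyclotomic_coset m CARD('a) (\<gamma> i))"
    and "disjoint_family_on (\<lambda>i. cyclotomic_coset m CARD('a) (\<gamma> i)) {1..t}"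
    and "\<And>i. i \<in> {1..<t} \<Longrightarrow> d i = \<gamma> (i + 1) - \<gamma> i"
    and "d\<^sub>f = nat (Gcd (d ` {1..<t} \<union> {int m, int CARD('a) - 1}))"
  shows "minimal_binomial_order f = m div d\<^sub>f \<and>
    (\<forall>i\<in>{1..t}. map_poly to_ac (minimal_binomial_multiple f) =
             monom 1 (m div d\<^sub>f) - [:\<zeta> m powi (\<gamma> i * int (m div d\<^sub>f)):])"
proof -
  define z where "z = \<zeta> m"
  define T where "T = defining_set \<zeta> f"
  define q where "q = CARD('a)"
  define S where "S = d ` {1..<t} \<union> {int m, int q - 1}"
  define n\<^sub>0 where "n\<^sub>0 = m div d\<^sub>f"
  have f0: "poly f 0 \<noteq> 0"
    using poly_nonzero_of_coprime_X assms(4) .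
  note ctx = f0 assms(3) assms(1)
  have z: "primitive_root_of_unity m z"
    using primitive_root_poly_order[OF ctx] by (simp add: z_def assms(5))
  have m: "m > 0"
    using poly_order_pos[OF f0] by (simp add: assms(5))
  have z0: "z \<noteq> 0"
    using z m by (auto simp: primitive_root_of_unity_def power_0_left)
  have q: "q > 0"
    by (simp add: q_def)
  note zeq = primitive_root_powi_eq_iff[OF z]
  have dvd_iff: "f dvd monom 1 n - [:c:] \<longleftrightarrow> (\<forall>\<gamma>\<in>T. (z powi \<gamma>) ^ n = to_ac c)" for n c
    using dvd_binomial_iff[OF ctx] by (simp add: T_def z_def assms(5))
  have T_iff: "k \<in> T \<longleftrightarrow> (\<exists>i\<in>{1..t}. \<exists>j. k = (\<gamma> i * int q ^ j) mod int m)" for k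
    by (auto simp: T_def assms(6) cyclotomic_coset_def q_def)
  have zmod: "z powi (k mod int m) = z powi k" for k
    by (simp add: zeq mod_eq_dvd_iff[symmetric])
  have dS: "int d\<^sub>f = Gcd S"
    by (simp add: assms(9) S_def q_def)
  have dvdS: "int d\<^sub>f dvd s" if "s \<in> S" for s
    using that by (simp add: dS)
  have "d\<^sub>f dvd m"
    using dvdS[of "int m"] by (simp add: S_def)
  hence mn: "m = d\<^sub>f * n\<^sub>0"
    by (simp add: n\<^sub>0_def)
  have n0: "n\<^sub>0 > 0" and d0: "d\<^sub>f > 0"
    using m by (simp_all add: mn)
  have m_dvd: "int m dvd s * int n\<^sub>0" if "s \<in> S" for s
    using dvdS[OF that] unfolding mn of_nat_mult by (rule mult_dvd_mono) simp
  have d_diff: "d i = \<gamma> (Suc i) - \<gamma> i" if "i \<in> {1..<t}" for i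
    using assms(8)[OF that] by simp

  \<comment> \<open>The member \<open>j = 0\<close> of each coset is \<open>\<gamma> i\<close>
    reduced modulo \<open>m\<close>.\<close>
  have root: "z powi (\<gamma> i * int n) = to_ac c"
    if "f dvd monom 1 n - [:c:]" "i \<in> {1..t}" for n c i
  proof -
    have "(\<gamma> i * int q ^ 0) mod int m \<in> T"
      using that(2) unfolding T_iff by blast
    hence "(z powi (\<gamma> i mod int m)) ^ n = to_ac c"
      using that(1) by (simp add: dvd_iff)
    thus ?thesis
      by (simp add: zmod power_int_power')
  qed

  \<comment> \<open>Lower bound on the degree: \<open>m\<close> divides \<open>n * s\<close> for
    each \<open>s\<close> in \<open>S\<close>, hence \<open>n\<close> times their gcd
    \<open>d\<^sub>f\<close>, which is then cancelled.\<close>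
  have n0_dvd: "n\<^sub>0 dvd n" if c: "f dvd monom 1 n - [:c:]" "c \<noteq> 0" for n c
  proof -
    have "int m dvd int n * s" if "s \<in> S" for s
      using that unfolding S_def
    proof (elim UnE insertE emptyE imageE)
      fix i assume i: "s = d i" "i \<in> {1..<t}"
      hence "z powi (\<gamma> (Suc i) * int n) = z powi (\<gamma> i * int n)"
        using root[OF c(1), of i] root[OF c(1), of "Suc i"] by simp
      moreover have "\<gamma> (Suc i) * int n - \<gamma> i * int n = int n * d i"
        unfolding d_diff[OF i(2)] by (simp add: algebra_simps)
      ultimately show ?thesis
        by (simp add: zeq i(1))
    next
      assume s: "s = int q - 1"
      have "int m dvd int (n * (q - 1))"
        using poly_order_dvd_binomial_degree[OF ctx c] by (simp only: assms(5) q_def of_nat_dvd_iff)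
      thus ?thesis
        using q by (simp add: s of_nat_diff)
    qed simp
    hence "int m dvd Gcd ((*) (int n) ` S)"
      by (auto intro: Gcd_greatest)
    also have "Gcd ((*) (int n) ` S) = int (n * d\<^sub>f)"
      by (simp add: Gcd_mult dS[symmetric] abs_mult)
    finally have "d\<^sub>f * n\<^sub>0 dvd d\<^sub>f * n"
      unfolding mn by (simp only: of_nat_dvd_iff mult.commute)
    thus ?thesis
      using d0 by simp
  qed

  define y where "y = z powi (\<gamma> 1 * int n\<^sub>0)"
  \<comment> \<open>The value passes from one index to the next because \<open>m\<close> divides
    \<open>d i * n\<^sub>0\<close>. Indices start at 1: case 0 is vacuous, and \<open>i = 0\<close>
    in the successor case is the true base.\<close>
  have y: "z powi (\<gamma> i * int n\<^sub>0) = y" if "i \<in> {1..t}" for i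
    using that
  proof (induction i)
    case (Suc i)
    show ?case
    proof (cases "i = 0")
      case False
      with Suc.prems have i: "i \<in> {1..<t}"
        by simp
      hence "d i \<in> S"
        by (simp add: S_def)
      hence "z powi (\<gamma> (Suc i) * int n\<^sub>0) = z powi (\<gamma> i * int n\<^sub>0)"
        using m_dvd[of "d i"] unfolding zeq d_diff[OF i] left_diff_distrib by blast
      with Suc.IH i show ?thesis
        by simp
    qed (simp add: y_def)
  qed simp
  \<comment> \<open>Membership of \<open>q - 1\<close> in \<open>S\<close> makes \<open>y\<close> a
    fixed point of Frobenius, hence an element of the base field.\<close>
  have "int m dvd \<gamma> 1 * ((int q - 1) * int n\<^sub>0)"
    by (intro dvd_mult m_dvd) (simp add: S_def)
  hence "z powi (\<gamma> 1 * int n\<^sub>0 * int q) = y"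
    unfolding y_def zeq by (simp add: algebra_simps)
  hence yq: "y ^ q = y"
    by (simp add: y_def power_int_power')
  then obtain c where c: "y = to_ac c"
    using power_CARD_eq_self_imp_in_range_to_ac[of y] by (auto simp: q_def)
  have "y \<noteq> 0"
    using z0 by (simp add: y_def power_int_not_zero)
  with c have c0: "c \<noteq> 0"
    by auto
  have yqj: "y ^ (q ^ j) = y" for j
    by (induction j) (simp_all add: power_mult yq)
  \<comment> \<open>Moving along a coset raises the value to a power of \<open>q\<close>, which
    fixes \<open>y\<close>; so a whole coset behaves like its representative.\<close>
  have "(z powi k) ^ n\<^sub>0 = to_ac c" if "k \<in> T" for k
  proof -
    from that obtain i j where i: "i \<in> {1..t}" and k: "k = (\<gamma> i * int q ^ j) mod int m"
      unfolding T_iff by blast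
    have "(z powi k) ^ n\<^sub>0 = z powi (\<gamma> i * int n\<^sub>0 * int (q ^ j))"
      unfolding k zmod power_int_power' by (simp add: mult_ac)
    also have "\<dots> = (z powi (\<gamma> i * int n\<^sub>0)) ^ (q ^ j)"
      by (simp only: power_int_power')
    finally show ?thesis
      using y[OF i] yqj c by simp
  qed
  hence dvd: "f dvd monom 1 n\<^sub>0 - [:c:]"
    by (simp add: dvd_iff)

  have deg: "degree (monom 1 n - [:b:]) = n" if "n > 0" for n and b :: 'a
    using that by (intro degree_monom_diff) simp
  have "T \<noteq> {}"
    using defining_set_nonempty[OF ctx assms(2)] by (simp add: T_def)
  \<comment> \<open>There is at least one coset, so a root is at hand to pin down the constant term
    in the uniqueness argument.\<close>
  hence t: "1 \<in> {1..t}"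
    using T_iff by fastforce
  have min: "minimal_binomial_multiple f = monom 1 n\<^sub>0 - [:c:]"
    unfolding minimal_binomial_multiple_def
  proof (rule the_equality, safe)
    show "is_binomial (monom 1 n\<^sub>0 - [:c:])"
      using n0 c0 unfolding is_binomial_def by (intro exI[of _ n\<^sub>0] exI[of _ c]) simp
    show "f dvd monom 1 n\<^sub>0 - [:c:]"
      by (rule dvd)
  next
    fix h :: "'a poly" assume "is_binomial h" "f dvd h"
    then obtain n b where h: "h = monom 1 n - [:b:]" "n \<ge> 1" "b \<noteq> 0"
      by (auto simp: is_binomial_def)
    with \<open>f dvd h\<close> n0_dvd have "n\<^sub>0 \<le> n"
      by (auto intro: dvd_imp_le)
    thus "degree (monom 1 n\<^sub>0 - [:c:]) \<le> degree h"
      using h n0 by (simp add: deg)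
  next
    fix h :: "'a poly"
    assume "is_binomial h" and h_dvd: "f dvd h"
      and min: "\<forall>g. is_binomial g \<and> f dvd g \<longrightarrow> degree h \<le> degree g"
    then obtain n b where h: "h = monom 1 n - [:b:]" "n \<ge> 1" "b \<noteq> 0"
      by (auto simp: is_binomial_def)
    have "is_binomial (monom 1 n\<^sub>0 - [:c:])"
      using n0 c0 unfolding is_binomial_def by (intro exI[of _ n\<^sub>0] exI[of _ c]) simp
    hence "n \<le> n\<^sub>0"
      using min dvd h n0 by (auto simp: deg)
    moreover have "n\<^sub>0 \<le> n"
      using n0_dvd[of n b] h_dvd h by (auto intro: dvd_imp_le)
    ultimately have n: "n = n\<^sub>0"
      by simp
    \<comment> \<open>Both constants are the \<open>n\<^sub>0\<close>-th power of the same root, the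
      one with exponent \<open>\<gamma> 1\<close>.\<close>
    have "to_ac b = to_ac c"
      using root[OF _ t, of n b] root[OF dvd t] h_dvd h(1) n by simp
    thus "h = monom 1 n\<^sub>0 - [:c:]"
      using h(1) n by simp
  qed
  have "map_poly to_ac (minimal_binomial_multiple f) = monom 1 n\<^sub>0 - [:y:]"
    by (simp add: min map_poly_to_ac_diff map_poly_monom map_poly_pCons c)
  thus ?thesis
    using y n0 by (simp add: minimal_binomial_order_def min deg n\<^sub>0_def z_def)
qed

end
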